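(* Let $F$ be a ribbon graph, let $\alpha\neq -2,0,1$, $\beta=\alpha(1-\alpha)$ and $\gamma=1/\sqrt{\alpha\beta}$. Then \[ R(F\otimes C_3;\alpha,\beta,\gamma)=(\alpha+2)^{n(F)}\,R\!\left(F;\,\alpha(\alpha+2),\,\frac{\beta}{\alpha+2},\,\gamma\right). \]
   Context: A ribbon graph is a graph with a fixed cyclic order of half-edges at each vertex, regarded as an orientable surface with boundary (vertex discs joined by untwisted edge bands). $v,e,k$ denote numbers of vertices, edges, connected components; $r(H)=v(H)-k(H)$, $n(H)=e(H)-r(H)$; $p(H)$ is the number of boundary components of $H$ as a surface. A state is a spanning sub-ribbon graph (all vertices, a subset of edges); ${\mathcal S}(F)$ is the set of states. Bollobás–Riordan polynomial: $R(F;\alpha,\beta,\gamma)=\sum_{H\in{\mathcal S}(F)}\alpha^{r(F)-r(H)}\beta^{n(H)}\gamma^{k(H)-p(H)+n(H)}$. Tensor product with a cycle: $F\otimes C_p$ is obtained by identifying each edge of $F$ with a distinguished edge of its own copy of the $p$-cycle $C_p$ and then deleting the original edges (a 2-sum with $C_p$ at every edge); equivalently each edge of $F$ is replaced, within its band, by a path of $p-1$ edges through $p-2$ new degree-two vertices. In particular $F\otimes C_3$ is obtained by subdividing every edge of $F$ once. *)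

theory Defs
  imports Complex_Main "HOL-Combinatorics.Orbits"
begin

text \<open>
  Ribbon graphs are encoded by their half-edges (darts): \<open>vert d\<close> is the vertex carrying the
  half-edge \<open>d\<close>, \<open>opp d\<close> is the other half of the edge of \<open>d\<close>, and \<open>rot d\<close> is the successor of
  \<open>d\<close> in the cyclic order at \<open>vert d\<close>. The vertex set is kept separately, since vertices without
  half-edges must be allowed. Loops and multiple edges are allowed.
\<close>

record ('v, 'd) pre_ribbon_graph =
  verts :: "'v set"
  darts :: "'d set"
  vert :: "'d \<Rightarrow> 'v"
  opp :: "'d \<Rightarrow> 'd"
  rot :: "'d \<Rightarrow> 'd"

definition darts_at :: "('v, 'd) pre_ribbon_graph \<Rightarrow> 'v \<Rightarrow> 'd set" where
  "darts_at F v = {d \<in> darts F. vert F d = v}"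

locale ribbon_graph =
  fixes F :: "('v, 'd) pre_ribbon_graph"
  assumes finite_verts: "finite (verts F)"
    and finite_darts: "finite (darts F)"
    and vert_in_verts: "d \<in> darts F \<Longrightarrow> vert F d \<in> verts F"
    and opp_in_darts: "d \<in> darts F \<Longrightarrow> opp F d \<in> darts F"
    and opp_neq: "d \<in> darts F \<Longrightarrow> opp F d \<noteq> d"
    and opp_opp: "d \<in> darts F \<Longrightarrow> opp F (opp F d) = d"
    and rot_cyclic: "v \<in> verts F \<Longrightarrow> darts_at F v \<noteq> {} \<Longrightarrow> cyclic_on (rot F) (darts_at F v)"

definition edges :: "('v, 'd) pre_ribbon_graph \<Rightarrow> 'd set set" where
  "edges F = (\<lambda>d. {d, opp F d}) ` darts F"

definition adjacency :: "('v, 'd) pre_ribbon_graph \<Rightarrow> 'v rel" where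
  "adjacency F = (\<lambda>d. (vert F d, vert F (opp F d))) ` darts F"

definition components :: "('v, 'd) pre_ribbon_graph \<Rightarrow> 'v set set" where
  "components F = verts F // (adjacency F)\<^sup>*"

definition num_v :: "('v, 'd) pre_ribbon_graph \<Rightarrow> int" where
  "num_v F = int (card (verts F))"

definition num_e :: "('v, 'd) pre_ribbon_graph \<Rightarrow> int" where
  "num_e F = int (card (edges F))"

definition num_k :: "('v, 'd) pre_ribbon_graph \<Rightarrow> int" where
  "num_k F = int (card (components F))"

definition rk :: "('v, 'd) pre_ribbon_graph \<Rightarrow> int" where
  "rk F = num_v F - num_k F"

definition nul :: "('v, 'd) pre_ribbon_graph \<Rightarrow> int" where
  "nul F = num_e F - rk F"

text \<open>
  Since the bands are untwisted, a boundary component of the surface that meets some band follows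
  the side of a band from \<open>d\<close> to \<open>opp d\<close> and then the arc of the vertex disc from \<open>opp d\<close> to the next
  half-edge \<open>rot (opp d)\<close>; these components are the orbits of \<open>rot \<circ> opp\<close>, each band side being
  traversed once. Every other boundary component is the boundary circle of the disc of a vertex
  without half-edges.
\<close>

definition boundary_walks :: "('v, 'd) pre_ribbon_graph \<Rightarrow> 'd set set" where
  "boundary_walks F = orbit (rot F \<circ> opp F) ` darts F"

definition isolated_verts :: "('v, 'd) pre_ribbon_graph \<Rightarrow> 'v set" where
  "isolated_verts F = {v \<in> verts F. darts_at F v = {}}"

definition num_p :: "('v, 'd) pre_ribbon_graph \<Rightarrow> int" where
  "num_p F = int (card (boundary_walks F)) + int (card (isolated_verts F))"

text \<open>
  The cyclic order induced on a set \<open>B\<close> of half-edges: the successor of \<open>d\<close> is the first element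
  of \<open>B\<close> met when iterating \<open>rot\<close> from \<open>d\<close>.
\<close>

definition induced_rot :: "('d \<Rightarrow> 'd) \<Rightarrow> 'd set \<Rightarrow> 'd \<Rightarrow> 'd" where
  "induced_rot f B d = (f ^^ (LEAST n. 0 < n \<and> (f ^^ n) d \<in> B)) d"

definition spanning_sub ::
    "('v, 'd) pre_ribbon_graph \<Rightarrow> 'd set set \<Rightarrow> ('v, 'd) pre_ribbon_graph" where
  "spanning_sub F A = F\<lparr>darts := \<Union>A, rot := induced_rot (rot F) (\<Union>A)\<rparr>"

definition states :: "('v, 'd) pre_ribbon_graph \<Rightarrow> ('v, 'd) pre_ribbon_graph set" where
  "states F = {spanning_sub F A | A. A \<subseteq> edges F}"

text \<open>
  The three exponents are non-negative integers for every state of a ribbon graph (the last one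
  is twice the genus), so the integer powers below are ordinary powers.
\<close>

definition BR_poly :: "('v, 'd) pre_ribbon_graph \<Rightarrow> 'a::field \<Rightarrow> 'a \<Rightarrow> 'a \<Rightarrow> 'a" where
  "BR_poly F \<alpha> \<beta> \<gamma> =
     (\<Sum>H\<in>states F. \<alpha> powi (rk F - rk H) * \<beta> powi nul H * \<gamma> powi (num_k H - num_p H + nul H))"

text \<open>
  The tensor product with the \<open>p\<close>-cycle (\<open>p \<ge> 2\<close>): the edge \<open>{d, opp d}\<close> is replaced by a path of
  \<open>p - 1\<close> edges from \<open>vert d\<close> to \<open>vert (opp d)\<close>. With the vertices of this path numbered
  \<open>0, \<dots>, p - 1\<close> starting from \<open>vert d\<close>, the half-edge \<open>(d, i)\<close>, \<open>i < p - 1\<close>, is the one at vertex \<open>i\<close>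
  that points towards vertex \<open>i + 1\<close>. Numbering the path from the other end turns vertex \<open>i\<close> into
  vertex \<open>p - 1 - i\<close>, so the other half of this edge is \<open>(opp d, p - 2 - i)\<close>, and for \<open>i \<ge> 1\<close> the
  other half-edge at vertex \<open>i\<close> is \<open>(opp d, p - 1 - i)\<close>. A new vertex is encoded as the set of its
  two half-edges. The half-edge \<open>(d, 0)\<close> takes the place of \<open>d\<close> in the cyclic order at \<open>vert d\<close>.
\<close>

definition path_vert :: "('v, 'd) pre_ribbon_graph \<Rightarrow> nat \<Rightarrow> 'd \<times> nat \<Rightarrow> ('d \<times> nat) set" where
  "path_vert F p = (\<lambda>(d, i). {(d, i), (opp F d, p - 1 - i)})"

definition tensor_cycle ::
    "('v, 'd) pre_ribbon_graph \<Rightarrow> nat \<Rightarrow> ('v + ('d \<times> nat) set, 'd \<times> nat) pre_ribbon_graph" where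
  "tensor_cycle F p =
     \<lparr>verts = Inl ` verts F \<union> Inr ` path_vert F p ` (darts F \<times> {1..<p - 1}),
      darts = darts F \<times> {..<p - 1},
      vert = (\<lambda>(d, i). if i = 0 then Inl (vert F d) else Inr (path_vert F p (d, i))),
      opp = (\<lambda>(d, i). (opp F d, p - 2 - i)),
      rot = (\<lambda>(d, i). if i = 0 then (rot F d, 0) else (opp F d, p - 1 - i))\<rparr>"

end

theory Submission
  imports Defs
begin

text \<open>
  A state of the subdivided graph keeps both halves, one half or no half of each edge of \<open>F\<close>. Let \<open>H\<close>
  be the state of \<open>F\<close> formed by the edges of which both halves are kept. An edge with a single half
  kept contributes a pendant edge, which changes neither the number of components nor the number of
  boundary components; an edge with no half kept contributes an isolated vertex, which raises both
  by one. So a state over \<open>H\<close> has the nullity and the genus exponent of \<open>H\<close>, and differs from the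
  term of \<open>H\<close> only by a factor \<open>\<alpha>\<close> for each edge with no half kept. Summing over the states above \<open>H\<close>
  gives \<open>(\<alpha> + 2)\<close> to the power \<open>e(F) - e(H) = n(F) + (r(F) - r(H)) - n(H)\<close>, and these three summands
  are absorbed by the prefactor and the new arguments.

  For the boundary components, passing to a subset of half-edges replaces a permutation by its
  first-return map, whose orbits are the traces of the old orbits on the subset.
\<close>

subsection \<open>First-return maps\<close>

text \<open>An inductive counterpart of the least exponent in \<open>induced_rot\<close>: rule
  induction follows the trajectory step by step, and a derivation exists only if \<open>B\<close> is
  reached at all.\<close>

inductive first_hit :: "('a \<Rightarrow> 'a) \<Rightarrow> 'a set \<Rightarrow> 'a \<Rightarrow> 'a \<Rightarrow> bool" for f B where
  now: "f d \<in> B \<Longrightarrow> first_hit f B d (f d)"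
| later: "f d \<notin> B \<Longrightarrow> first_hit f B (f d) e \<Longrightarrow> first_hit f B d e"

lemma induced_rot_now: "f d \<in> B \<Longrightarrow> induced_rot f B d = f d"
proof -
  assume "f d \<in> B"
  then have "(LEAST n. 0 < n \<and> (f ^^ n) d \<in> B) = 1"
    by (intro Least_equality) auto
  then show ?thesis by (simp add: induced_rot_def)
qed

text \<open>Skipping a point outside \<open>B\<close> lowers the least exponent by one. The witness
  \<open>n\<close> guarantees that \<open>B\<close> is reached, so that \<open>LEAST\<close> is
  meaningful on both sides.\<close>

lemma induced_rot_later:
  assumes "f d \<notin> B" and "n > 0" and "(f ^^ n) (f d) \<in> B"
  shows "induced_rot f B d = induced_rot f B (f d)"
proof -
  have shift: "(f ^^ Suc m) d = (f ^^ m) (f d)" for m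
    by (simp only: funpow_Suc_right comp_apply)
  have "(LEAST n. 0 < n \<and> (f ^^ n) d \<in> B) = Suc (LEAST m. 0 < Suc m \<and> (f ^^ Suc m) d \<in> B)"
    by (rule Least_Suc[where n = "Suc n"]) (use assms in \<open>simp_all only: shift\<close>, auto)
  also have "(LEAST m. 0 < Suc m \<and> (f ^^ Suc m) d \<in> B) = (LEAST m. 0 < m \<and> (f ^^ m) (f d) \<in> B)"
  proof (rule arg_cong[where f = Least], rule ext)
    fix m
    show "(0 < Suc m \<and> (f ^^ Suc m) d \<in> B) = (0 < m \<and> (f ^^ m) (f d) \<in> B)"
      unfolding shift using assms(1) by (cases m) auto
  qed
  finally show ?thesis
    unfolding induced_rot_def by (simp only: shift)
qed

lemma first_hit_iterate:
  "first_hit f B d e \<Longrightarrow> \<exists>n>0. (f ^^ n) d = e \<and> e \<in> B"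
proof (induction rule: first_hit.induct)
  case (now d)
  then show ?case by (intro exI[of _ 1]) simp
next
  case (later d e)
  then obtain n where "(f ^^ n) (f d) = e" "e \<in> B" by blast
  then show ?case
    by (intro exI[of _ "Suc n"]) (simp add: funpow_swap1)
qed

lemma first_hit_in: "first_hit f B d e \<Longrightarrow> e \<in> B"
  using first_hit_iterate by fast

lemma first_hit_in_orbit: "first_hit f B d e \<Longrightarrow> e \<in> orbit f d"
  using first_hit_iterate by (fastforce simp: orbit_altdef)

lemma first_hit_induced_rot:
  "first_hit f B d e \<Longrightarrow> induced_rot f B d = e"
proof (induction rule: first_hit.induct)
  case (now d)
  then show ?case by (rule induced_rot_now)
next
  case (later d e)
  then obtain n where "n > 0" "(f ^^ n) (f d) \<in> B"
    using first_hit_iterate by metis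
  with later show ?case using induced_rot_later by metis
qed

lemma first_hit_exists:
  assumes "e \<in> orbit f d" "e \<in> B"
  shows "first_hit f B d (induced_rot f B d)"
proof -
  have "\<exists>e'. first_hit f B d e'" if "(f ^^ Suc n) d \<in> B" for n
    using that
  proof (induction n arbitrary: d)
    case 0
    then show ?case using first_hit.now[of f d B] by auto
  next
    case (Suc n)
    show ?case
    proof (cases "f d \<in> B")
      case False
      have "(f ^^ Suc n) (f d) \<in> B"
        using Suc.prems by (simp add: funpow_swap1)
      with Suc.IH False show ?thesis by (blast intro: first_hit.later)
    qed (blast intro: first_hit.now)
  qed
  moreover obtain n where "(f ^^ Suc n) d \<in> B"
    using assms by (auto simp: orbit_altdef gr0_conv_Suc)
  ultimately show ?thesis
    using first_hit_induced_rot by metis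
qed

text \<open>The trajectory of \<open>induced_rot f S\<close> is that of \<open>f\<close> with the
  points outside \<open>S\<close> skipped, and since \<open>T \<subseteq> S\<close> no point of
  \<open>T\<close> is skipped.\<close>

lemma first_hit_first_return:
  assumes "first_hit f T d e" and "T \<subseteq> S"
  shows "first_hit (induced_rot f S) T d e"
  using assms(1)
proof (induction rule: first_hit.induct)
  case (now d)
  then have "induced_rot f S d = f d"
    using assms(2) by (blast intro: induced_rot_now)
  with now show ?case by (metis first_hit.now)
next
  case (later d e)
  show ?case
  proof (cases "f d \<in> S")
    case True
    then have "induced_rot f S d = f d" by (rule induced_rot_now)
    with later show ?thesis by (metis first_hit.later)
  next
    case False
    obtain n where "n > 0" "(f ^^ n) (f d) \<in> S"
      using first_hit_iterate[OF later(2)] assms(2) by blast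
    then have "induced_rot f S d = induced_rot f S (f d)"
      using False induced_rot_later by metis
    \<comment> \<open>\<open>first_hit\<close> sees its starting point only through the image of
      that point, and \<open>d\<close> and \<open>f d\<close> have the same image under
      \<open>induced_rot f S\<close>.\<close>
    with later.IH show ?thesis
      by (metis first_hit.simps)
  qed
qed

text \<open>Only the first application of \<open>\<theta>\<close> matters: the points passed before
  the hit lie outside \<open>T\<close>, where \<open>\<theta>\<close> is the identity.\<close>

lemma first_hit_comp:
  assumes "first_hit g T (\<theta> d) e" and "\<And>x. x \<notin> T \<Longrightarrow> \<theta> x = x"
  shows "first_hit (g \<circ> \<theta>) T d e"
  using assms(1)
proof (induction "\<theta> d" e arbitrary: d rule: first_hit.induct)
  case now
  then show ?case using first_hit.now[of "g \<circ> \<theta>"] by simp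
next
  case (later e)
  then have "first_hit (g \<circ> \<theta>) T (g (\<theta> d)) e" using assms(2) by simp
  with later show ?case using first_hit.later[of "g \<circ> \<theta>"] by simp
qed

lemma first_hit_semiconj:
  assumes "first_hit f S d e" and "\<And>x. f' (h x) = h (f x)" and "\<And>x. h x \<in> S' \<longleftrightarrow> x \<in> S"
  shows "first_hit f' S' (h d) (h e)"
  using assms(1)
proof (induction rule: first_hit.induct)
  case (now d)
  then show ?case using first_hit.now[of f' "h d" S'] assms by simp
next
  case (later d e)
  then show ?case using first_hit.later[of f' "h d" S'] assms by simp
qed

subsection \<open>Orbits of a self-map all of whose points are recurrent\<close>

text \<open>On a finite \<open>X\<close> this says that \<open>f\<close> permutes \<open>X\<close>.
  Unlike \<open>permutes\<close>, it asks nothing of \<open>f\<close> outside \<open>X\<close>,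
  where the maps of a ribbon graph are arbitrary.\<close>

definition recurrent_on :: "('a \<Rightarrow> 'a) \<Rightarrow> 'a set \<Rightarrow> bool" where
  "recurrent_on f X \<longleftrightarrow> (\<forall>x\<in>X. f x \<in> X \<and> x \<in> orbit f x)"

lemma recurrent_on_orbit_subset:
  assumes "recurrent_on f X" "x \<in> X" shows "orbit f x \<subseteq> X"
proof
  fix y assume "y \<in> orbit f x"
  then show "y \<in> X"
    by induction (use assms in \<open>auto simp: recurrent_on_def\<close>)
qed

lemma recurrent_on_orbit_eq:
  assumes "recurrent_on f X" "x \<in> X" "y \<in> orbit f x"
  shows "orbit f y = orbit f x"
proof -
  have "x \<in> orbit f y"
    using assms orbit_swap unfolding recurrent_on_def by metis
  then show ?thesis using assms(3) by (auto intro: orbit_trans)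
qed

text \<open>Recurrence is what the orbit arguments use, while bijectivity is what is visibly closed
  under composition.\<close>

lemma recurrent_on_iff_bij_betw:
  assumes "finite X"
  shows "recurrent_on f X \<longleftrightarrow> bij_betw f X X"
proof
  assume rec: "recurrent_on f X"
  have "X \<subseteq> f ` X"
  proof
    fix x assume x: "x \<in> X"
    then have "x \<in> orbit f x" using rec by (simp add: recurrent_on_def)
    then show "x \<in> f ` X"
      by cases (use x recurrent_on_orbit_subset[OF rec x] in auto)
  qed
  moreover have "f ` X \<subseteq> X" using rec by (auto simp: recurrent_on_def)
  ultimately have "f ` X = X" by blast
  then show "bij_betw f X X"
    using assms finite_surj_inj[of X f] by (simp add: bij_betw_def)
next
  assume bij: "bij_betw f X X"
  \<comment> \<open>The extension by the identity outside \<open>X\<close> is a permutation of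
    finite support, so each point lies in its own orbit.\<close>
  define g where "g = perm_restrict f X"
  have "bij_betw g X X"
    using bij by (rule bij_betw_cong[THEN iffD1, rotated]) (simp add: g_def perm_restrict_def)
  then have "g permutes X"
    by (rule bij_imp_permutes) (simp add: g_def perm_restrict_def)
  then have perm: "permutation g" using assms by (auto simp: permutation_permutes)
  have "orbit f x = orbit g x" if "x \<in> X" for x
    using that bij by (intro orbit_cong0) (auto simp: g_def perm_restrict_def bij_betw_def)
  then show "recurrent_on f X"
    using bij permutation_self_in_orbit[OF perm]
    by (auto simp: recurrent_on_def bij_betw_def)
qed

lemma recurrent_on_comp:
  assumes "finite X" "recurrent_on f X" "recurrent_on g X"
  shows "recurrent_on (f \<circ> g) X"
  using assms by (simp add: recurrent_on_iff_bij_betw bij_betw_trans)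

lemma recurrent_on_involution:
  assumes "\<And>x. x \<in> X \<Longrightarrow> f x \<in> X" "\<And>x. x \<in> X \<Longrightarrow> f (f x) = x"
  shows "recurrent_on f X"
  unfolding recurrent_on_def
  using assms by (metis orbit.base orbit.step)

lemma recurrent_on_first_hit:
  assumes "recurrent_on f X" "B \<subseteq> X" "d \<in> B"
  shows "first_hit f B d (induced_rot f B d)"
  using assms by (intro first_hit_exists[of d]) (auto simp: recurrent_on_def)

lemma orbit_induced_rot:
  assumes rec: "recurrent_on f X" and "B \<subseteq> X" and "d \<in> B"
  shows "orbit (induced_rot f B) d = orbit f d \<inter> B"
proof
  note hit = recurrent_on_first_hit[OF rec assms(2)]
  show "orbit (induced_rot f B) d \<subseteq> orbit f d \<inter> B"
  proof
    fix y assume "y \<in> orbit (induced_rot f B) d"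
    then show "y \<in> orbit f d \<inter> B"
    proof induction
      case base
      show ?case using hit[OF assms(3)] first_hit_in first_hit_in_orbit by fast
    next
      case (step y)
      then have "first_hit f B y (induced_rot f B y)" using hit by blast
      with step show ?case using first_hit_in first_hit_in_orbit orbit_trans by fast
    qed
  qed
  \<comment> \<open>Strong induction on the number \<open>n\<close> of \<open>f\<close>-steps from
    \<open>d\<close> to \<open>e\<close>: the first return to \<open>B\<close> uses up
    \<open>k \<le> n\<close> of them, and the remaining \<open>n - k\<close> steps start again in
    \<open>B\<close>.\<close>
  have "e \<in> orbit (induced_rot f B) d \<or> d \<notin> B"
    if "(f ^^ n) d = e" "n > 0" "e \<in> B" for n e d
    using that
  proof (induction n arbitrary: d rule: less_induct)
    case (less n)
    show ?case
    proof (cases "d \<in> B")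
      case True
      define k where "k = (LEAST n. 0 < n \<and> (f ^^ n) d \<in> B)"
      have n: "0 < n \<and> (f ^^ n) d \<in> B" using less.prems by simp
      then have k: "0 < k \<and> (f ^^ k) d \<in> B"
        unfolding k_def by (rule LeastI)
      from n have "k \<le> n"
        unfolding k_def by (rule Least_le)
      have ind: "induced_rot f B d = (f ^^ k) d" by (simp add: induced_rot_def k_def)
      show ?thesis
      proof (cases "k = n")
        case True
        then show ?thesis using ind less.prems orbit.base by metis
      next
        case False
        have "(f ^^ (n - k)) ((f ^^ k) d) = e"
          using \<open>k \<le> n\<close> less.prems by (simp flip: funpow_add[THEN fun_cong, unfolded comp_apply])
        then have "e \<in> orbit (induced_rot f B) ((f ^^ k) d)"
          using less.IH[of "n - k" "(f ^^ k) d"] False k \<open>k \<le> n\<close> less.prems by simp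
        then show ?thesis using ind orbit_subset by metis
      qed
    qed simp
  qed
  then show "orbit f d \<inter> B \<subseteq> orbit (induced_rot f B) d"
    using assms(3) by (auto simp: orbit_altdef[of f])
qed

lemma recurrent_on_induced_rot:
  assumes "recurrent_on f X" "B \<subseteq> X"
  shows "recurrent_on (induced_rot f B) B"
  unfolding recurrent_on_def
  using assms orbit_induced_rot[OF assms] recurrent_on_first_hit[OF assms] first_hit_in
  by (fastforce simp: recurrent_on_def)

text \<open>Distinct orbits are disjoint by recurrence, so an orbit meeting \<open>B\<close> is
  determined by its trace on \<open>B\<close>.\<close>

lemma card_orbits_induced_rot:
  assumes "recurrent_on f X" "B \<subseteq> X"
  shows "card (orbit (induced_rot f B) ` B) = card (orbit f ` B)"
proof -
  have "orbit (induced_rot f B) ` B = (\<lambda>Z. Z \<inter> B) ` orbit f ` B"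
    using orbit_induced_rot[OF assms] by (force simp: image_image)
  moreover have "inj_on (\<lambda>Z. Z \<inter> B) (orbit f ` B)"
  proof (rule inj_onI, clarify)
    fix x y assume xy: "x \<in> B" "y \<in> B" "orbit f x \<inter> B = orbit f y \<inter> B"
    then have "x \<in> orbit f y" using assms by (auto simp: recurrent_on_def)
    then show "orbit f x = orbit f y"
      using recurrent_on_orbit_eq[OF assms(1)] xy assms(2) by blast
  qed
  ultimately show ?thesis by (simp add: card_image)
qed

lemma orbit_cong_on:
  assumes "recurrent_on f X" "\<And>x. x \<in> X \<Longrightarrow> g x = f x" "x \<in> X"
  shows "orbit g x = orbit f x"
  using assms recurrent_on_orbit_subset[OF assms(1,3)]
  by (intro orbit_cong) (auto simp: recurrent_on_def)

subsection \<open>States of the subdivided graph\<close>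

text \<open>Choosing a subset of a disjoint union amounts to choosing a subset of each block
  independently, so the sum factors by distributivity.\<close>

lemma sum_Pow_Union_disjoint:
  fixes g :: "'a set \<Rightarrow> 'a set \<Rightarrow> 'b::comm_semiring_1"
  assumes "finite E" and "\<And>e. e \<in> E \<Longrightarrow> finite e" and "pairwise disjnt E"
  shows "(\<Sum>S\<in>Pow (\<Union>E). \<Prod>e\<in>E. g e (S \<inter> e)) = (\<Prod>e\<in>E. \<Sum>X\<in>Pow e. g e X)"
  using assms
proof (induction E rule: finite_induct)
  case empty
  show ?case by simp
next
  case (insert e E)
  have disj: "e \<inter> \<Union>E = {}"
    using insert.prems(2) insert.hyps(2) by (auto simp: pairwise_insert disjnt_def)
  have "(\<Sum>S\<in>Pow (\<Union>(insert e E)). \<Prod>e'\<in>insert e E. g e' (S \<inter> e'))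
      = (\<Sum>(X, Y)\<in>Pow e \<times> Pow (\<Union>E). g e X * (\<Prod>e'\<in>E. g e' (Y \<inter> e')))"
  proof (rule sum.reindex_bij_witness[where j = "\<lambda>S. (S \<inter> e, S \<inter> \<Union>E)" and i = "\<lambda>(X, Y). X \<union> Y"])
    fix S assume "S \<in> Pow (\<Union>(insert e E))"
    have "S \<inter> \<Union>E \<inter> e' = S \<inter> e'" if "e' \<in> E" for e' using that by blast
    then show "(case (S \<inter> e, S \<inter> \<Union>E) of (X, Y) \<Rightarrow> g e X * (\<Prod>e'\<in>E. g e' (Y \<inter> e')))
        = (\<Prod>e'\<in>insert e E. g e' (S \<inter> e'))"
      using insert.hyps by simp
  qed (use disj in auto)
  also have "\<dots> = (\<Sum>X\<in>Pow e. g e X) * (\<Sum>Y\<in>Pow (\<Union>E). \<Prod>e'\<in>E. g e' (Y \<inter> e'))"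
    by (simp add: sum_product sum.cartesian_product)
  also have "(\<Sum>Y\<in>Pow (\<Union>E). \<Prod>e'\<in>E. g e' (Y \<inter> e')) = (\<Prod>e'\<in>E. \<Sum>X\<in>Pow e'. g e' X)"
    using insert.prems by (intro insert.IH) (auto simp: pairwise_insert)
  finally show ?case using insert.hyps by simp
qed

text \<open>\<open>f\<close> is a complete invariant for \<open>R\<close> on \<open>V\<close>, so
  its values count the classes. Components of a state are counted by exhibiting such an
  invariant.\<close>

lemma card_quotient_eq_card_image:
  assumes "\<And>x y. x \<in> V \<Longrightarrow> (x, y) \<in> R \<longleftrightarrow> y \<in> V \<and> f x = f y"
  shows "card (V // R) = card (f ` V)"
proof -
  have "V // R = (\<lambda>c. {y \<in> V. f y = c}) ` f ` V"
    using assms by (fastforce simp: quotient_def image_image)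
  moreover have "inj_on (\<lambda>c. {y \<in> V. f y = c}) (f ` V)"
    by (rule inj_onI) blast
  ultimately show ?thesis by (simp add: card_image)
qed

lemma spanning_sub_simps [simp]:
  "verts (spanning_sub F A) = verts F" "darts (spanning_sub F A) = \<Union>A"
  "vert (spanning_sub F A) = vert F" "opp (spanning_sub F A) = opp F"
  "rot (spanning_sub F A) = induced_rot (rot F) (\<Union>A)"
  by (simp_all add: spanning_sub_def)

context ribbon_graph
begin

text \<open>
  Each dart \<open>d\<close> of \<open>F\<close> yields one edge of the subdivided graph, the half at \<open>vert d\<close> of the edge of
  \<open>d\<close>; hence the states of the subdivided graph correspond to the sets of darts of \<open>F\<close>.
\<close>

definition half_edge :: "'d \<Rightarrow> ('d \<times> nat) set" where
  "half_edge d = {(d, 0), (opp F d, 1)}"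

abbreviation subdiv :: "('v + ('d \<times> nat) set, 'd \<times> nat) pre_ribbon_graph" where
  "subdiv \<equiv> tensor_cycle F 3"

abbreviation sub_state :: "'d set \<Rightarrow> ('v + ('d \<times> nat) set, 'd \<times> nat) pre_ribbon_graph" where
  "sub_state S \<equiv> spanning_sub subdiv (half_edge ` S)"

definition full_edges :: "'d set \<Rightarrow> 'd set set" where
  "full_edges S = {e \<in> edges F. e \<subseteq> S}"

definition empty_edges :: "'d set \<Rightarrow> 'd set set" where
  "empty_edges S = {e \<in> edges F. e \<inter> S = {}}"

section \<open>Edges as a partition of the half-edges\<close>

lemma finite_edges: "finite (edges F)"
  by (simp add: edges_def finite_darts)

lemma edges_subset_darts: "e \<in> edges F \<Longrightarrow> e \<subseteq> darts F"
  by (auto simp: edges_def opp_in_darts)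

lemma edge_nonempty: "e \<in> edges F \<Longrightarrow> \<exists>d. d \<in> e"
  by (auto simp: edges_def)

lemma edge_eqI: "e \<in> edges F \<Longrightarrow> d \<in> e \<Longrightarrow> e = {d, opp F d}"
  by (auto simp: edges_def opp_opp)

lemma edges_disjoint: "e \<in> edges F \<Longrightarrow> e' \<in> edges F \<Longrightarrow> e \<inter> e' \<noteq> {} \<Longrightarrow> e = e'"
  using edge_eqI by (metis disjoint_iff)

lemma Union_edges: "\<Union>(edges F) = darts F"
  by (auto simp: edges_def opp_in_darts)

text \<open>\<open>spanning_sub\<close> records an edge set only through the union of its edges;
  this makes the correspondence between edge sets and states one to one.\<close>

lemma Union_edges_inject:
  assumes "A \<subseteq> edges F" "B \<subseteq> edges F" "\<Union>A = \<Union>B"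
  shows "A = B"
proof -
  have "A \<subseteq> B" if AB: "A \<subseteq> edges F" "B \<subseteq> edges F" "\<Union>A = \<Union>B" for A B
  proof
    fix e assume e: "e \<in> A"
    then obtain d where "d \<in> e" using AB(1) edge_nonempty by blast
    with e AB(3) obtain e' where "e' \<in> B" "d \<in> e'" by blast
    moreover have "e = e'"
      using edge_eqI[of e d] edge_eqI[of e' d] e AB(1,2) \<open>d \<in> e\<close> calculation by blast
    ultimately show "e \<in> B" by simp
  qed
  from this[OF assms] this[OF assms(2,1) assms(3)[symmetric]] show ?thesis by (rule subset_antisym)
qed

lemma edges_spanning_sub:
  assumes "A \<subseteq> edges F" shows "edges (spanning_sub F A) = A"
proof -
  have "(\<lambda>d. {d, opp F d}) d \<in> A" if "d \<in> e" "e \<in> A" for d e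
    using that edge_eqI assms by (metis subsetD)
  moreover have "e \<in> (\<lambda>d. {d, opp F d}) ` \<Union>A" if e: "e \<in> A" for e
  proof -
    obtain d where "d \<in> e" using e assms edge_nonempty by blast
    moreover have "e = {d, opp F d}" using edge_eqI[of e d] calculation that assms by blast
    ultimately show ?thesis using that by (intro image_eqI[of _ _ d]) auto
  qed
  ultimately have "(\<lambda>d. {d, opp F d}) ` \<Union>A = A" by (intro equalityI image_subsetI subsetI) auto
  then show ?thesis by (simp add: edges_def)
qed

lemma Union_full_edges:
  assumes "S \<subseteq> darts F"
  shows "\<Union>(full_edges S) = {d \<in> S. opp F d \<in> S}"
  using assms by (force simp: full_edges_def edges_def opp_opp)

lemma inj_spanning_sub: "inj_on (spanning_sub F) (Pow (edges F))"
proof (rule inj_onI)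
  fix A B assume "A \<in> Pow (edges F)" "B \<in> Pow (edges F)" "spanning_sub F A = spanning_sub F B"
  moreover from this have "\<Union>A = \<Union>B" by (metis spanning_sub_simps(2))
  ultimately show "A = B" using Union_edges_inject by simp
qed

section \<open>The subdivided graph and its states\<close>

lemma subdiv_verts: "verts subdiv = Inl ` verts F \<union> Inr ` (\<lambda>e. e \<times> {1}) ` edges F"
proof -
  \<comment> \<open>For \<open>p = 3\<close> and \<open>i = 1\<close> the partner index
    \<open>p - 1 - i\<close> is again \<open>1\<close>, so the midpoint of an edge \<open>e\<close>
    is encoded as \<open>e \<times> {1}\<close>.\<close>
  have *: "path_vert F 3 (d, 1) = {d, opp F d} \<times> {1}" for d
    by (auto simp: path_vert_def)
  have "{1..<3 - 1::nat} = {1}" by auto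
  then have "path_vert F 3 ` (darts F \<times> {1..<3 - 1}) = (\<lambda>e. e \<times> {1}) ` edges F"
    using * by (auto simp: edges_def image_iff)
  then show ?thesis by (simp add: tensor_cycle_def)
qed

lemma subdiv_darts: "darts subdiv = darts F \<times> {0, 1}"
  by (auto simp: tensor_cycle_def)

lemma subdiv_simps [simp]:
  "vert subdiv (d, 0) = Inl (vert F d)"
  "vert subdiv (d, Suc 0) = Inr ({d, opp F d} \<times> {1})"
  "opp subdiv (d, 0) = (opp F d, 1)"
  "opp subdiv (d, Suc 0) = (opp F d, 0)"
  "rot subdiv (d, 0) = (rot F d, 0)"
  "rot subdiv (d, Suc 0) = (opp F d, 1)"
  by (auto simp: tensor_cycle_def path_vert_def numeral_3_eq_3)

lemma inj_half_edge: "inj half_edge"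
  by (rule injI) (auto simp: half_edge_def doubleton_eq_iff)

lemma Union_half_edges:
  assumes "S \<subseteq> darts F"
  shows "(d, 0) \<in> \<Union>(half_edge ` S) \<longleftrightarrow> d \<in> S"
    and "d \<in> darts F \<Longrightarrow> (d, Suc 0) \<in> \<Union>(half_edge ` S) \<longleftrightarrow> opp F d \<in> S"
    and "x \<in> \<Union>(half_edge ` S) \<longleftrightarrow> (\<exists>d\<in>S. x = (d, 0) \<or> x = (opp F d, Suc 0))"
  using assms by (auto simp: half_edge_def opp_opp) (metis opp_opp subsetD)

lemma edges_image_half_edges:
  assumes "S \<subseteq> darts F"
  shows "(\<lambda>x. {x, opp subdiv x}) ` \<Union>(half_edge ` S) = half_edge ` S"
proof -
  have "{x, opp subdiv x} = half_edge d" if "d \<in> S" "x \<in> half_edge d" for x d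
    using that assms opp_opp[of d] by (auto simp: half_edge_def)
  then have "(\<lambda>x. {x, opp subdiv x}) ` half_edge d = {half_edge d}" if "d \<in> S" for d
    using that by (auto simp: half_edge_def)
  then show ?thesis by (auto simp: image_UN)
qed

lemma subdiv_darts_eq_Union: "darts subdiv = \<Union>(half_edge ` darts F)"
proof -
  have "(d, i) \<in> darts F \<times> {0, 1} \<longleftrightarrow> (d, i) \<in> \<Union>(half_edge ` darts F)" for d i
    unfolding Union_half_edges(3)[OF subset_refl] using opp_in_darts opp_opp by force
  then show ?thesis unfolding subdiv_darts by (metis subrelI subset_antisym)
qed

lemma subdiv_edges: "edges subdiv = half_edge ` darts F"
  unfolding edges_def subdiv_darts_eq_Union by (simp add: edges_image_half_edges)

lemma states_subdiv: "states subdiv = sub_state ` Pow (darts F)"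
proof -
  have "states subdiv = spanning_sub subdiv ` Pow (half_edge ` darts F)"
    unfolding states_def subdiv_edges by blast
  also have "Pow (half_edge ` darts F) = image half_edge ` Pow (darts F)"
    by (rule image_Pow_surj[symmetric]) (rule refl)
  finally show ?thesis by (simp add: image_image)
qed

lemma inj_sub_state: "inj_on sub_state (Pow (darts F))"
proof (rule inj_onI)
  fix S T assume *: "S \<in> Pow (darts F)" "T \<in> Pow (darts F)" "sub_state S = sub_state T"
  then have "\<Union>(half_edge ` S) = \<Union>(half_edge ` T)" by (metis spanning_sub_simps(2))
  then have "d \<in> S \<longleftrightarrow> d \<in> T" for d
    using * Union_half_edges(1)[of S d] Union_half_edges(1)[of T d] by simp
  then show "S = T" by blast
qed

section \<open>Vertex and edge counts of a state\<close>

lemma num_v_sub_state: "num_v (sub_state S) = num_v F + num_e F"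
proof -
  have "inj_on (\<lambda>e. e \<times> {1::nat}) (edges F)" by (rule inj_onI) auto
  then have "card ((\<lambda>e. e \<times> {1::nat}) ` edges F) = card (edges F)" by (rule card_image)
  moreover have "card (verts subdiv) = card (verts F) + card ((\<lambda>e. e \<times> {1::nat}) ` edges F)"
    unfolding subdiv_verts
    by (subst card_Un_disjoint) (auto simp: finite_verts finite_edges card_image)
  ultimately show ?thesis by (simp add: num_v_def num_e_def)
qed

lemma edges_sub_state:
  assumes "S \<subseteq> darts F" shows "edges (sub_state S) = half_edge ` S"
  using edges_image_half_edges[OF assms] by (simp add: edges_def)

lemma num_e_sub_state:
  assumes "S \<subseteq> darts F"
  shows "num_e (sub_state S) = int (card (full_edges S)) + num_e F - int (card (empty_edges S))"
proof -
  have fin: "finite S" using assms finite_darts finite_subset by blast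
  have "num_e (sub_state S) = int (card S)"
    unfolding num_e_def edges_sub_state[OF assms]
    by (simp add: card_image inj_half_edge[THEN inj_on_subset])
  also have "card S = card (\<Union>e\<in>edges F. e \<inter> S)"
    using assms Union_edges by (intro arg_cong[where f = card]) blast
  also have "int \<dots> = int (\<Sum>e\<in>edges F. card (e \<inter> S))"
    using finite_edges fin edges_disjoint by (subst card_UN_disjoint) auto
  \<comment> \<open>An edge has two, one or no darts in \<open>S\<close>: starting from 1, a full
    edge adds one and an empty edge removes one.\<close>
  also have "\<dots> = (\<Sum>e\<in>edges F. of_bool (e \<subseteq> S) + 1 - of_bool (e \<inter> S = {}))"
    unfolding of_nat_sum
  proof (rule sum.cong)
    fix e assume "e \<in> edges F"
    then obtain d where "d \<in> darts F" "e = {d, opp F d}" by (auto simp: edges_def)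
    then show "int (card (e \<inter> S)) = of_bool (e \<subseteq> S) + 1 - of_bool (e \<inter> S = {})"
      using opp_neq[of d] by (cases "d \<in> S"; cases "opp F d \<in> S") auto
  qed simp
  also have "\<dots> = int (card (full_edges S)) + num_e F - int (card (empty_edges S))"
    by (simp add: sum.distrib sum_subtractf finite_edges full_edges_def empty_edges_def num_e_def
        of_bool_def sum.If_cases Int_def)
  finally show ?thesis .
qed

subsection \<open>Connected components\<close>

lemma num_k_sub_state:
  assumes S: "S \<subseteq> darts F"
  shows "num_k (sub_state S) = num_k (spanning_sub F (full_edges S)) + int (card (empty_edges S))"
proof -
  define R where "R = (adjacency (spanning_sub F (full_edges S)))\<^sup>*"
  define R' where "R' = (adjacency (sub_state S))\<^sup>*"
  define T where "T = {d \<in> S. opp F d \<in> S}"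
  define c where "c v = R `` {v}" for v
  \<comment> \<open>The invariant: an old vertex gets its component in the state of full edges, a
    midpoint with a kept half gets that of the end of this half, and any other midpoint gets its
    edge. If both halves are kept, their ends are adjacent through the full edge, so the choice made
    by \<open>SOME\<close> does not matter.\<close>
  define f where "f x = (case x of Inl v \<Rightarrow> Inl (c v)
    | Inr y \<Rightarrow> if fst ` y \<inter> S = {} then Inr (fst ` y)
        else Inl (c (vert F (SOME d. d \<in> fst ` y \<inter> S))))" for x :: "'v + ('d \<times> nat) set"
  define N where "N d = (Inr ({d, opp F d} \<times> {1}) :: 'v + ('d \<times> nat) set)" for d
  have N_opp: "N (opp F d) = N d" if "d \<in> S" for d
    using that S opp_opp[of d] by (auto simp: N_def)
  have adj: "adjacency (spanning_sub F (full_edges S)) = (\<lambda>d. (vert F d, vert F (opp F d))) ` T"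
    by (simp add: adjacency_def Union_full_edges[OF S] T_def)
  \<comment> \<open>Each kept half joins an old vertex to a midpoint; its two darts give the two
    directions.\<close>
  have adj': "adjacency (sub_state S) = (\<Union>d\<in>S. {(Inl (vert F d), N d), (N d, Inl (vert F d))})"
  proof -
    have "(\<lambda>x. (vert subdiv x, vert subdiv (opp subdiv x))) ` half_edge d
        = {(Inl (vert F d), N d), (N d, Inl (vert F d))}" if "d \<in> S" for d
      using that S opp_opp[of d] by (auto simp: half_edge_def N_def)
    then show ?thesis by (simp add: adjacency_def image_UN)
  qed
  have sym: "sym R"
    unfolding R_def adj by (intro sym_rtrancl)
      (use S in \<open>auto simp: sym_def T_def image_iff opp_opp subset_iff\<close>)
  have sym': "sym R'"
    unfolding R'_def adj' by (intro sym_rtrancl) (auto simp: sym_def)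
  have trans: "trans R" "trans R'" by (simp_all add: R_def R'_def trans_rtrancl)
  have c_eq: "c v = c w" if "(v, w) \<in> R" for v w
    using that sym trans(1) unfolding c_def by (blast dest: symD transD)
  have c_eqD: "(v, w) \<in> R" if "c v = c w" for v w
    using that unfolding c_def R_def by blast
  have fN: "f (N d) = Inl (c (vert F d))" if d: "d \<in> S" for d
  proof -
    let ?y = "{d, opp F d} \<times> {1::nat}"
    define d' where "d' = (SOME x. x \<in> fst ` ?y \<inter> S)"
    have y: "fst ` ?y = {d, opp F d}" by force
    have "d' \<in> fst ` ?y \<inter> S" unfolding d'_def by (rule someI[of _ d]) (use d y in auto)
    then have "d' = d \<or> d' = opp F d \<and> d \<in> T" using y d by (auto simp: T_def)
    then have "c (vert F d') = c (vert F d)"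
      using c_eq[of "vert F d" "vert F (opp F d)"] by (auto simp: R_def adj)
    moreover have "fst ` ?y \<inter> S \<noteq> {}" using d y by auto
    then have "f (N d) = Inl (c (vert F d'))"
      by (simp only: N_def f_def d'_def sum.case if_False)
    ultimately show ?thesis by simp
  qed
  have V': "verts (sub_state S) = Inl ` verts F \<union> N ` darts F"
    by (simp add: subdiv_verts edges_def image_image N_def)
  have step': "y \<in> verts (sub_state S) \<and> f x = f y"
    if "(x, y) \<in> adjacency (sub_state S)" for x y
    using that S vert_in_verts unfolding adj' V' by (auto simp: fN) (auto simp: f_def)
  \<comment> \<open>A step along a full edge lifts to two steps through the midpoint, which both
    darts of the edge share.\<close>
  have lift: "(Inl v, Inl w) \<in> R'" if "(v, w) \<in> R" for v w
    using that unfolding R_def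
  proof induction
    case base
    show ?case by (simp add: R'_def)
  next
    case (step w z)
    then obtain d where d: "d \<in> T" "w = vert F d" "z = vert F (opp F d)"
      unfolding adj by blast
    then have "(Inl w, N d) \<in> adjacency (sub_state S)"
        "(N (opp F d), Inl z) \<in> adjacency (sub_state S)"
      unfolding adj' by (auto simp: T_def)
    then have "(Inl w, N d) \<in> R'" "(N (opp F d), Inl z) \<in> R'"
      unfolding R'_def by blast+
    moreover have "N (opp F d) = N d" using d N_opp by (simp add: T_def)
    ultimately have "(Inl w, Inl z) \<in> R'" using trans(2) by (metis transD)
    with step.IH show ?case using trans(2) by (meson transD)
  qed
  \<comment> \<open>Every vertex is connected to an old vertex with the same value of
    \<open>f\<close>, or is an isolated midpoint. So for \<open>Inl\<close> values it is enough to
    connect old vertices, which \<open>lift\<close> does.\<close>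
  have repr: "(\<exists>v\<in>verts F. (x, Inl v) \<in> R' \<and> f x = Inl (c v)) \<or>
      (\<exists>e\<in>empty_edges S. x = Inr (e \<times> {1}) \<and> f x = Inr e)" if "x \<in> verts (sub_state S)" for x
    using that unfolding V'
  proof
    assume "x \<in> Inl ` verts F"
    then show ?thesis by (auto simp: f_def R'_def)
  next
    assume "x \<in> N ` darts F"
    then obtain d where d: "d \<in> darts F" "x = N d" by blast
    have *: ?thesis if "d \<in> S" "x = N d" for d
    proof -
      have "(N d, Inl (vert F d)) \<in> R'" unfolding R'_def adj' using that by blast
      then show ?thesis using that fN S vert_in_verts by blast
    qed
    show ?thesis
    proof (cases "d \<in> S \<or> opp F d \<in> S")
      case True
      then show ?thesis using *[of d] *[of "opp F d"] d N_opp[of "opp F d"] opp_opp[of d] by metis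
    next
      case False
      have y: "fst ` ({d, opp F d} \<times> {1::nat}) = {d, opp F d}" by force
      then have "f x = Inr {d, opp F d}" using False d by (auto simp: f_def N_def)
      moreover have "{d, opp F d} \<in> empty_edges S"
        using False d by (auto simp: empty_edges_def edges_def)
      ultimately show ?thesis using d by (auto simp: N_def)
    qed
  qed
  have R': "(x, y) \<in> R' \<longleftrightarrow> y \<in> verts (sub_state S) \<and> f x = f y"
    if x: "x \<in> verts (sub_state S)" for x y
  proof
    assume "(x, y) \<in> R'"
    then show "y \<in> verts (sub_state S) \<and> f x = f y"
      unfolding R'_def by induction (use x step' in auto)
  next
    assume y: "y \<in> verts (sub_state S) \<and> f x = f y"
    show "(x, y) \<in> R'"
    proof (cases "f x")
      case (Inl z)
      then obtain v w where "(x, Inl v) \<in> R'" "(y, Inl w) \<in> R'" "c v = c w"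
        using repr[OF x] repr[of y] y by auto
      then show ?thesis using lift[OF c_eqD[of v w]] sym' trans(2) by (meson symD transD)
    next
      case (Inr e)
      then have "x = y" using repr[OF x] repr[of y] y by auto
      then show ?thesis by (simp add: R'_def)
    qed
  qed
  have comps: "components (spanning_sub F (full_edges S)) = c ` verts F"
    by (auto simp: components_def quotient_def c_def R_def)
  have "f ` verts (sub_state S) = Inl ` c ` verts F \<union> Inr ` empty_edges S"
  proof
    show "f ` verts (sub_state S) \<subseteq> Inl ` c ` verts F \<union> Inr ` empty_edges S"
      using repr by fastforce
    have "Inl (c v) \<in> f ` verts (sub_state S)" if "v \<in> verts F" for v
      using that by (intro image_eqI[of _ _ "Inl v"]) (auto simp: f_def subdiv_verts)
    moreover have "Inr e \<in> f ` verts (sub_state S)" if "e \<in> empty_edges S" for e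
    proof (rule image_eqI[of _ _ "Inr (e \<times> {1})"])
      have "fst ` (e \<times> {1::nat}) = e" by force
      then show "Inr e = f (Inr (e \<times> {1}))" using that by (auto simp: f_def empty_edges_def)
      show "Inr (e \<times> {1}) \<in> verts (sub_state S)"
        using that by (auto simp: empty_edges_def subdiv_verts)
    qed
    ultimately show "Inl ` c ` verts F \<union> Inr ` empty_edges S \<subseteq> f ` verts (sub_state S)" by blast
  qed
  moreover have "card (components (sub_state S)) = card (f ` verts (sub_state S))"
    unfolding components_def R'_def[symmetric] using R' by (rule card_quotient_eq_card_image)
  moreover have "card (Inl ` c ` verts F \<union> Inr ` empty_edges S)
      = card (c ` verts F) + card (empty_edges S)"
    by (subst card_Un_disjoint) (auto simp: card_image finite_verts empty_edges_def finite_edges)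
  ultimately show ?thesis by (simp add: num_k_def comps)
qed

subsection \<open>Boundary components\<close>

lemma orbit_rot: "d \<in> darts F \<Longrightarrow> orbit (rot F) d = darts_at F (vert F d)"
  by (rule orbit_cyclic_eq3, rule rot_cyclic) (auto simp: darts_at_def vert_in_verts)

lemma recurrent_on_rot: "recurrent_on (rot F) (darts F)"
proof -
  have "d \<in> orbit (rot F) d" "rot F d \<in> darts F" if "d \<in> darts F" for d
    using orbit_rot[OF that] orbit.base[of "rot F" d] that by (auto simp: darts_at_def)
  then show ?thesis by (simp add: recurrent_on_def)
qed

text \<open>The rotation copies that of \<open>F\<close> at the old vertices and swaps the two darts
  at each midpoint.\<close>

lemma recurrent_on_rot_subdiv: "recurrent_on (rot subdiv) (darts subdiv)"
proof -
  have "(rot subdiv ^^ n) (d, 0) = ((rot F ^^ n) d, 0)" for n d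
    by (induction n) auto
  then have "(d, 0) \<in> orbit (rot subdiv) (d, 0)" if "d \<in> darts F" for d
    using recurrent_on_rot that by (fastforce simp: recurrent_on_def orbit_altdef)
  moreover have "(d, Suc 0) \<in> orbit (rot subdiv) (d, Suc 0)" if "d \<in> darts F" for d
    using orbit.step[OF orbit.base, of "rot subdiv" "(d, Suc 0)"] that by (simp add: opp_opp)
  ultimately show ?thesis
    using recurrent_on_rot opp_in_darts by (auto simp: recurrent_on_def subdiv_darts)
qed

lemma isolated_verts_sub_state:
  assumes S: "S \<subseteq> darts F"
  shows "isolated_verts (sub_state S) =
    Inl ` {v \<in> verts F. darts_at F v \<inter> S = {}} \<union> Inr ` (\<lambda>e. e \<times> {1}) ` empty_edges S"
proof -
  have "darts_at (sub_state S) (Inl v) = {} \<longleftrightarrow> darts_at F v \<inter> S = {}" for v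
    using S by (fastforce simp: darts_at_def half_edge_def)
  moreover have "darts_at (sub_state S) (Inr (e \<times> {1})) = {} \<longleftrightarrow> e \<inter> S = {}"
    if e: "e \<in> edges F" for e
  proof -
    have "vert subdiv (opp F d, Suc 0) = Inr (e \<times> {1}) \<longleftrightarrow> d \<in> e" if "d \<in> S" for d
    proof -
      have "vert subdiv (opp F d, Suc 0) = Inr (e \<times> {1}) \<longleftrightarrow> {d, opp F d} = e"
      proof -
        have "{opp F d, opp F (opp F d)} = {d, opp F d}" using S that opp_opp[of d] by auto
        moreover have "{d, opp F d} \<times> {1::nat} = e \<times> {1} \<longleftrightarrow> {d, opp F d} = e" by blast
        ultimately show ?thesis by simp
      qed
      then show ?thesis using edge_eqI[OF e, of d] by auto
    qed
    then have "(\<forall>d\<in>S. vert subdiv (opp F d, Suc 0) \<noteq> Inr (e \<times> {1})) \<longleftrightarrow> e \<inter> S = {}"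
      by blast
    moreover have "darts_at (sub_state S) y = {} \<longleftrightarrow>
        (\<forall>d\<in>S. vert subdiv (d, 0) \<noteq> y \<and> vert subdiv (opp F d, Suc 0) \<noteq> y)" for y
      unfolding darts_at_def spanning_sub_simps Union_half_edges(3)[OF S] by blast
    ultimately show ?thesis by simp
  qed
  moreover have "{x \<in> Inl ` V \<union> Inr ` M ` E. P x} =
      Inl ` {v \<in> V. P (Inl v)} \<union> Inr ` M ` {e \<in> E. P (Inr (M e))}"
    for V :: "'v set" and M :: "'d set \<Rightarrow> ('d \<times> nat) set" and E P
    by auto
  ultimately show ?thesis
    unfolding isolated_verts_def empty_edges_def spanning_sub_simps(1) subdiv_verts
    by (simp cong: conj_cong)
qed

text \<open>Watching a boundary walk only at the darts \<open>(d, 0)\<close> turns the walks into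
  orbits of a permutation \<open>\<psi>\<close> of \<open>S\<close>. Those meeting the set
  \<open>T\<close> of darts of full edges correspond to the walks of the state of full edges; each
  remaining one surrounds a single vertex and is counted by the last term.\<close>

lemma card_boundary_walks_sub_state:
  assumes S: "S \<subseteq> darts F"
  shows "card (boundary_walks (sub_state S)) =
    card (boundary_walks (spanning_sub F (full_edges S))) +
    card {v \<in> verts F. darts_at F v \<inter> S \<noteq> {} \<and> darts_at F v \<inter> \<Union>(full_edges S) = {}}"
proof -
  define T where "T = {d \<in> S. opp F d \<in> S}"
  have T_Union: "\<Union>(full_edges S) = T" by (simp add: T_def Union_full_edges[OF S])
  have opp_S: "opp F (opp F d) = d" if "d \<in> S" for d using that S opp_opp by blast
  have T: "T \<subseteq> S" "T \<subseteq> darts F" "\<And>d. d \<in> T \<Longrightarrow> opp F d \<in> T"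
    using S opp_S by (auto simp: T_def)
  have fin: "finite S" using S finite_darts finite_subset by blast
  define g where "g = induced_rot (rot F) S"
  define \<theta> where "\<theta> d = (if d \<in> T then opp F d else d)" for d
  define \<psi> where "\<psi> = g \<circ> \<theta>"
  define X where "X = \<Union>(half_edge ` S)"
  define \<rho> where "\<rho> = induced_rot (rot subdiv) X"
  define \<phi> where "\<phi> = \<rho> \<circ> opp subdiv"
  define h where "h d = (d, 0::nat)" for d :: 'd
  have X_iff: "(d, 0) \<in> X \<longleftrightarrow> d \<in> S" "d \<in> darts F \<Longrightarrow> (d, Suc 0) \<in> X \<longleftrightarrow> opp F d \<in> S"
    and X_cases: "x \<in> X \<longleftrightarrow> (\<exists>d\<in>S. x = (d, 0) \<or> x = (opp F d, Suc 0))" for d x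
    unfolding X_def using Union_half_edges[OF S] by auto
  have rec_g: "recurrent_on g S"
    unfolding g_def using recurrent_on_rot S by (rule recurrent_on_induced_rot)
  have "recurrent_on \<theta> S"
    by (rule recurrent_on_involution) (use opp_S T(3) in \<open>auto simp: \<theta>_def T_def\<close>)
  then have rec_\<psi>: "recurrent_on \<psi> S"
    unfolding \<psi>_def using fin rec_g by (intro recurrent_on_comp)
  have "finite X" unfolding X_def using fin by (auto simp: half_edge_def)
  moreover have "X \<subseteq> darts subdiv"
    unfolding X_def subdiv_darts_eq_Union using S by blast
  then have "recurrent_on \<rho> X"
    unfolding \<rho>_def by (rule recurrent_on_induced_rot[OF recurrent_on_rot_subdiv])
  moreover have "recurrent_on (opp subdiv) X"
    by (rule recurrent_on_involution) (auto simp: X_cases opp_S)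
  ultimately have rec_\<phi>: "recurrent_on \<phi> X"
    unfolding \<phi>_def by (rule recurrent_on_comp)

  have g_hit: "first_hit (rot F) S d (g d)" if "d \<in> S" for d
    unfolding g_def using recurrent_on_rot S that by (rule recurrent_on_first_hit)
  have gS: "g d \<in> S" if "d \<in> S" for d
    using rec_g that by (simp add: recurrent_on_def)
  have \<rho>0: "\<rho> (d, 0) = (g d, 0)" if "d \<in> S" for d
    unfolding \<rho>_def
    using first_hit_semiconj[OF g_hit[OF that], of "rot subdiv" h X] X_iff(1)
    by (intro first_hit_induced_rot) (simp add: h_def)
  \<comment> \<open>At a midpoint with both halves kept the two darts alternate. With one half kept,
    the rotation passes over the missing dart and the remaining dart is its own successor.\<close>
  have \<rho>1: "\<rho> (opp F d, Suc 0) = (if opp F d \<in> S then d else opp F d, Suc 0)" if d: "d \<in> S" for d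
  proof (cases "opp F d \<in> S")
    case True
    then show ?thesis
      unfolding \<rho>_def using d S by (subst induced_rot_now) (auto simp: X_iff opp_S)
  next
    case False
    have "first_hit (rot subdiv) X (d, Suc 0) (opp F d, Suc 0)"
      using first_hit.now[of "rot subdiv" "(d, Suc 0)" X] d by (auto simp: X_cases)
    then have "first_hit (rot subdiv) X (opp F d, Suc 0) (opp F d, Suc 0)"
      using first_hit.later[of "rot subdiv" "(opp F d, Suc 0)" X] False d S
      by (auto simp: X_iff opp_S)
    then show ?thesis
      unfolding \<rho>_def using False by (simp add: first_hit_induced_rot)
  qed
  \<comment> \<open>Two boundary steps of the subdivided state lead from \<open>(d, 0)\<close> to \<open>(\<psi> d, 0)\<close>: \<open>\<theta>\<close> turns around
    at the tip of a pendant edge and crosses a fully kept edge.\<close>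
  have \<phi>_hit: "first_hit \<phi> (h ` S) (h d) (h (\<psi> d))" if d: "d \<in> S" for d
  proof -
    have "\<phi> (h d) \<notin> h ` S" using d by (auto simp: \<phi>_def h_def \<rho>1)
    moreover have "\<phi> (\<phi> (h d)) = h (\<psi> d)"
      using d by (cases "opp F d \<in> S") (auto simp: \<phi>_def h_def \<rho>0 \<rho>1 \<psi>_def \<theta>_def T_def opp_S)
    moreover have "\<psi> d \<in> S" using rec_\<psi> d by (simp add: recurrent_on_def)
    ultimately show ?thesis
      using first_hit.now[of \<phi> "\<phi> (h d)" "h ` S"] by (simp add: first_hit.later)
  qed
  have hS: "h ` S \<subseteq> X" by (auto simp: h_def X_iff)
  \<comment> \<open>A boundary step out of \<open>(opp F d, Suc 0)\<close> lands on
    \<open>(g d, 0)\<close>, so every walk passes through a dart with second component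
    \<open>0\<close>.\<close>
  have "orbit \<phi> x \<in> orbit \<phi> ` h ` S" if "x \<in> X" for x
  proof -
    from that obtain d where d: "d \<in> S" "x = (d, 0) \<or> x = (opp F d, Suc 0)"
      by (auto simp: X_cases)
    moreover have "orbit \<phi> (\<phi> x) = orbit \<phi> x"
      using rec_\<phi> that by (intro self_in_orbit_step) (simp add: recurrent_on_def)
    moreover have "\<phi> (opp F d, Suc 0) = h (g d)"
      using d by (simp add: \<phi>_def opp_S \<rho>0 h_def)
    ultimately show ?thesis using gS by (auto simp: h_def image_iff) metis
  qed
  then have "orbit \<phi> ` X = orbit \<phi> ` h ` S" using hS by blast
  then have "card (orbit \<phi> ` X) = card (orbit (induced_rot \<phi> (h ` S)) ` h ` S)"
    using card_orbits_induced_rot[OF rec_\<phi> hS] by simp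
  also have "orbit (induced_rot \<phi> (h ` S)) ` h ` S = image h ` orbit \<psi> ` S"
  proof -
    have "h ` orbit \<psi> d = orbit (induced_rot \<phi> (h ` S)) (h d)" if d: "d \<in> S" for d
    proof (rule orbit_inverse)
      show "d \<in> orbit \<psi> d" using rec_\<psi> d by (simp add: recurrent_on_def)
      fix x assume "x \<in> orbit \<psi> d"
      then have "x \<in> S" using recurrent_on_orbit_subset[OF rec_\<psi> d] by blast
      then show "induced_rot \<phi> (h ` S) (h x) = h (\<psi> x)"
        using \<phi>_hit first_hit_induced_rot by metis
    qed
    then show ?thesis by (simp add: image_image)
  qed
  also have "card (image h ` orbit \<psi> ` S) = card (orbit \<psi> ` S)"
  proof (intro card_image inj_onI)
    have "inj h" by (simp add: h_def inj_def)
    then show "Y = Z" if "h ` Y = h ` Z" for Y Z using that by (simp add: inj_image_eq_iff)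
  qed
  finally have card': "card (boundary_walks (sub_state S)) = card (orbit \<psi> ` S)"
    unfolding boundary_walks_def spanning_sub_simps X_def[symmetric] \<phi>_def \<rho>_def .

  \<comment> \<open>The boundary map of the state of full edges is the first return of
    \<open>\<psi>\<close> to \<open>T\<close>: both cross the edge of \<open>d\<close> and then
    rotate, and until \<open>T\<close> is met again \<open>\<theta>\<close> is the identity, so
    \<open>\<psi>\<close> merely rotates within \<open>S\<close>.\<close>
  have \<psi>_T: "(induced_rot (rot F) T \<circ> opp F) d = induced_rot \<psi> T d" if d: "d \<in> T" for d
  proof -
    have "first_hit (rot F) T (opp F d) (induced_rot (rot F) T (opp F d))"
      using recurrent_on_rot T(2) T(3)[OF d] by (rule recurrent_on_first_hit)
    then have "first_hit g T (\<theta> d) (induced_rot (rot F) T (opp F d))"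
      unfolding g_def using d T(1) by (simp add: first_hit_first_return \<theta>_def)
    then have "first_hit \<psi> T d (induced_rot (rot F) T (opp F d))"
      unfolding \<psi>_def by (rule first_hit_comp) (simp add: \<theta>_def)
    then show ?thesis by (simp add: first_hit_induced_rot)
  qed
  have "orbit (induced_rot (rot F) T \<circ> opp F) ` T = orbit (induced_rot \<psi> T) ` T"
    by (rule image_cong[OF refl], rule orbit_cong_on[OF recurrent_on_induced_rot[OF rec_\<psi> T(1)]])
      (rule \<psi>_T)
  then have card_T: "card (boundary_walks (spanning_sub F (full_edges S))) = card (orbit \<psi> ` T)"
    using card_orbits_induced_rot[OF rec_\<psi> T(1)]
    by (simp add: boundary_walks_def T_Union)

  \<comment> \<open>The orbits of \<open>\<psi>\<close> missing \<open>T\<close> run around the vertices all of whose kept edges are pendant.\<close>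
  define W where "W = {v \<in> verts F. darts_at F v \<inter> S \<noteq> {} \<and> darts_at F v \<inter> T = {}}"
  have orbit_g: "orbit g x = darts_at F (vert F x) \<inter> S" if "x \<in> S" for x
    unfolding g_def using orbit_induced_rot[OF recurrent_on_rot S that] orbit_rot S that by auto
  have \<psi>_off: "\<psi> x = g x" if "x \<notin> T" for x using that by (simp add: \<psi>_def \<theta>_def)
  have self: "x \<in> orbit g x" "x \<in> orbit \<psi> x" if "x \<in> S" for x
    using rec_g rec_\<psi> that by (simp_all add: recurrent_on_def)
  have orbit_W: "orbit \<psi> x = darts_at F (vert F x) \<inter> S"
    if "x \<in> S" "darts_at F (vert F x) \<inter> T = {}" for x
  proof -
    have "orbit \<psi> x = orbit g x"
      by (rule orbit_cong, rule self(1)[OF that(1)], rule \<psi>_off)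
        (use that orbit_g[OF that(1)] in auto)
    then show ?thesis by (simp only: orbit_g[OF that(1)])
  qed
  have orbit_T: "orbit \<psi> x \<in> orbit \<psi> ` T"
    if x: "x \<in> S" "darts_at F (vert F x) \<inter> T \<noteq> {}" for x
  proof -
    \<comment> \<open>On an orbit missing \<open>T\<close> the maps \<open>\<psi>\<close> and
      \<open>g\<close> agree, so it would consist of all darts of \<open>S\<close> at the vertex of
      \<open>x\<close>, and one of these lies in \<open>T\<close>.\<close>
    have "orbit \<psi> x \<inter> T \<noteq> {}"
    proof
      assume "orbit \<psi> x \<inter> T = {}"
      then have "orbit g x = orbit \<psi> x"
        by (intro orbit_cong self(2) x \<psi>_off[symmetric]) auto
      with \<open>orbit \<psi> x \<inter> T = {}\<close> show False using x T(1) orbit_g[OF x(1)] by auto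
    qed
    then obtain t where "t \<in> orbit \<psi> x" "t \<in> T" by blast
    then show ?thesis
      using recurrent_on_orbit_eq[OF rec_\<psi> x(1)] by (intro image_eqI[of _ _ t]) simp_all
  qed
  have "orbit \<psi> ` S = orbit \<psi> ` T \<union> (\<lambda>v. darts_at F v \<inter> S) ` W"
  proof
    show "orbit \<psi> ` S \<subseteq> orbit \<psi> ` T \<union> (\<lambda>v. darts_at F v \<inter> S) ` W"
    proof (rule image_subsetI)
      fix x assume x: "x \<in> S"
      show "orbit \<psi> x \<in> orbit \<psi> ` T \<union> (\<lambda>v. darts_at F v \<inter> S) ` W"
      proof (cases "darts_at F (vert F x) \<inter> T = {}")
        case True
        then have "vert F x \<in> W" using x S vert_in_verts by (auto simp: W_def darts_at_def)
        then show ?thesis using orbit_W[OF x True] by blast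
      qed (use orbit_T[OF x] in blast)
    qed
    have "darts_at F v \<inter> S \<in> orbit \<psi> ` S" if v: "v \<in> W" for v
    proof -
      obtain x where x: "x \<in> S" "vert F x = v" using v by (auto simp: W_def darts_at_def)
      moreover have "darts_at F v \<inter> T = {}" using v by (simp add: W_def)
      ultimately have "darts_at F v \<inter> S = orbit \<psi> x" using orbit_W[of x] by simp
      then show ?thesis using x(1) by (rule image_eqI)
    qed
    then show "orbit \<psi> ` T \<union> (\<lambda>v. darts_at F v \<inter> S) ` W \<subseteq> orbit \<psi> ` S" using T(1) by blast
  qed
  moreover have "orbit \<psi> ` T \<inter> (\<lambda>v. darts_at F v \<inter> S) ` W = {}"
  proof -
    have "t \<in> orbit \<psi> t" if "t \<in> T" for t using self(2) T(1) that by blast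
    moreover have "t \<notin> darts_at F v \<inter> S" if "v \<in> W" "t \<in> T" for v t
      using that by (auto simp: W_def)
    ultimately have "orbit \<psi> t \<noteq> darts_at F v \<inter> S" if "v \<in> W" "t \<in> T" for v t
      using that by metis
    then show ?thesis by auto
  qed
  moreover have "inj_on (\<lambda>v. darts_at F v \<inter> S) W"
    by (rule inj_onI) (auto simp: W_def darts_at_def)
  moreover have "finite W" "finite T"
    using finite_verts fin T(1) finite_subset by (auto simp: W_def)
  ultimately have "card (orbit \<psi> ` S) = card (orbit \<psi> ` T) + card W"
    by (simp add: card_Un_disjoint card_image)
  then show ?thesis by (simp add: card' card_T W_def T_Union)
qed

text \<open>A vertex of \<open>?W\<close>, all of whose kept edges are pendant, has a boundary walk
  around it in the subdivided state but is isolated in the state of full edges. It counts once on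
  either side, and only the isolated midpoints make a difference.\<close>

lemma num_p_sub_state:
  assumes S: "S \<subseteq> darts F"
  shows "num_p (sub_state S) = num_p (spanning_sub F (full_edges S)) + int (card (empty_edges S))"
proof -
  let ?T = "\<Union>(full_edges S)"
  let ?V = "{v \<in> verts F. darts_at F v \<inter> S = {}}"
  let ?W = "{v \<in> verts F. darts_at F v \<inter> S \<noteq> {} \<and> darts_at F v \<inter> ?T = {}}"
  have T: "?T \<subseteq> S" by (auto simp: full_edges_def)
  then have "darts_at (spanning_sub F (full_edges S)) v = darts_at F v \<inter> ?T" for v
    using S by (auto simp: darts_at_def)
  then have "isolated_verts (spanning_sub F (full_edges S)) = ?V \<union> ?W"
    using T unfolding isolated_verts_def by auto
  moreover have "card (?V \<union> ?W) = card ?V + card ?W"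
    using finite_verts by (intro card_Un_disjoint) auto
  moreover have "card (isolated_verts (sub_state S)) = card ?V + card (empty_edges S)"
  proof -
    have "inj_on (\<lambda>e. e \<times> {1::nat}) (empty_edges S)" by (rule inj_onI) auto
    then show ?thesis
      unfolding isolated_verts_sub_state[OF S]
      by (subst card_Un_disjoint)
        (auto simp: finite_verts finite_edges card_image empty_edges_def)
  qed
  ultimately show ?thesis
    using card_boundary_walks_sub_state[OF S] by (simp add: num_p_def)
qed

subsection \<open>The state sum\<close>

text \<open>Both the condition \<open>full_edges S = A\<close> and the weight are products of
  conditions and weights on the single edges, so the sum factors over the edges.\<close>

lemma sum_over_full_edges:
  fixes a :: "'a::comm_ring_1"
  assumes A: "A \<subseteq> edges F"
  shows "(\<Sum>S | S \<in> Pow (darts F) \<and> full_edges S = A. a ^ card (empty_edges S))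
    = (a + 2) ^ card (edges F - A)"
proof -
  \<comment> \<open>An edge of \<open>A\<close> must be full. Any other edge must not be; it has
    weight \<open>a\<close> if empty and 1 for either single half, in total
    \<open>a + 2\<close>.\<close>
  define g :: "'d set \<Rightarrow> 'd set \<Rightarrow> 'a" where
    "g e X = (if e \<in> A then of_bool (X = e) else if X = e then 0 else if X = {} then a else 1)" for e X
  have prod: "(\<Prod>e\<in>edges F. g e (S \<inter> e)) = (if full_edges S = A then a ^ card (empty_edges S) else 0)"
    for S
  proof (cases "full_edges S = A")
    case True
    have "g e (S \<inter> e) = (if e \<in> empty_edges S then a else 1)" if "e \<in> edges F" for e
      using that True edge_nonempty[OF that]
      by (auto simp: g_def full_edges_def empty_edges_def)
    then have "(\<Prod>e\<in>edges F. g e (S \<inter> e)) = (\<Prod>e\<in>edges F. if e \<in> empty_edges S then a else 1)"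
      by (rule prod.cong[OF refl])
    also have "\<dots> = a ^ card (edges F \<inter> empty_edges S)"
      by (simp add: prod.If_cases finite_edges)
    also have "edges F \<inter> empty_edges S = empty_edges S" by (auto simp: empty_edges_def)
    finally show ?thesis using True by simp
  next
    case False
    then obtain e where "e \<in> edges F" "e \<in> A \<longleftrightarrow> \<not> e \<subseteq> S"
      using A by (auto simp: full_edges_def)
    then have "g e (S \<inter> e) = 0" by (auto simp: g_def)
    then show ?thesis using False \<open>e \<in> edges F\<close> finite_edges by (auto intro: prod_zero)
  qed
  have sum: "(\<Sum>X\<in>Pow e. g e X) = (if e \<in> A then 1 else a + 2)" if e: "e \<in> edges F" for e
  proof -
    obtain d where d: "d \<in> darts F" "e = {d, opp F d}" using e by (auto simp: edges_def)
    have "Pow e = {{}, {d}, {opp F d}, {d, opp F d}}" unfolding d by blast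
    then show ?thesis
      using d opp_neq[OF d(1)] opp_neq[OF d(1), symmetric]
      by (auto simp: g_def doubleton_eq_iff algebra_simps)
  qed
  have "(\<Sum>S | S \<in> Pow (darts F) \<and> full_edges S = A. a ^ card (empty_edges S))
      = (\<Sum>S\<in>Pow (darts F). \<Prod>e\<in>edges F. g e (S \<inter> e))"
    unfolding prod using finite_darts by (intro sum.mono_neutral_cong_left) auto
  also have "\<dots> = (\<Sum>S\<in>Pow (\<Union>(edges F)). \<Prod>e\<in>edges F. g e (S \<inter> e))"
    by (simp only: Union_edges)
  also have "\<dots> = (\<Prod>e\<in>edges F. \<Sum>X\<in>Pow e. g e X)"
  proof (rule sum_Pow_Union_disjoint[OF finite_edges])
    show "finite e" if "e \<in> edges F" for e
      using that by (auto simp: edges_def)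
    show "pairwise disjnt (edges F)"
      unfolding pairwise_def disjnt_def using edges_disjoint by metis
  qed
  also have "\<dots> = (\<Prod>e\<in>edges F. if e \<in> A then 1 else a + 2)"
    using sum by (rule prod.cong[OF refl])
  also have "\<dots> = (a + 2) ^ card (edges F - A)"
    by (simp add: prod.If_cases finite_edges Diff_eq)
  finally show ?thesis .
qed

text \<open>Components do not depend on the rotation, so the component count for states applies with
  all darts kept, where every edge is full and none is empty.\<close>

lemma rk_subdiv: "rk subdiv = rk F + num_e F"
proof -
  let ?G = "spanning_sub F (edges F)"
  have full: "full_edges (darts F) = edges F" and empty: "empty_edges (darts F) = {}"
    using edges_subset_darts edge_nonempty by (fastforce simp: full_edges_def empty_edges_def)+
  have "num_k ?G = num_k F"
    by (simp add: num_k_def components_def adjacency_def Union_edges)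
  moreover have "num_k (sub_state (darts F)) = num_k subdiv"
    by (simp add: num_k_def components_def adjacency_def subdiv_darts_eq_Union)
  moreover have "num_v (sub_state (darts F)) = num_v subdiv"
    by (simp add: num_v_def)
  ultimately show ?thesis
    using num_k_sub_state[OF subset_refl] num_v_sub_state[of "darts F"]
    by (simp add: rk_def full empty)
qed

text \<open>Each empty edge lowers the edge count of the state by one and raises its component count
  by one, which cancels in the nullity but lowers the rank. Its extra boundary component cancels its
  extra component in the third exponent.\<close>

lemma BR_poly_term_sub_state:
  fixes a b c :: "'a::field"
  assumes S: "S \<subseteq> darts F" and "a \<noteq> 0"
  defines "G \<equiv> sub_state S" and "H \<equiv> spanning_sub F (full_edges S)"
  shows "a powi (rk subdiv - rk G) * b powi nul G * c powi (num_k G - num_p G + nul G)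
    = a ^ card (empty_edges S)
      * (a powi (rk F - rk H) * b powi nul H * c powi (num_k H - num_p H + nul H))"
proof -
  have "num_e H = int (card (full_edges S))"
    unfolding H_def num_e_def by (subst edges_spanning_sub) (auto simp: full_edges_def)
  moreover have "num_v H = num_v F" by (simp add: H_def num_v_def)
  moreover note num_v_sub_state[of S] num_e_sub_state[OF S] num_k_sub_state[OF S]
    num_p_sub_state[OF S]
  ultimately have "rk subdiv - rk G = int (card (empty_edges S)) + (rk F - rk H)"
    "nul G = nul H" "num_k G - num_p G = num_k H - num_p H"
    unfolding G_def H_def rk_subdiv by (simp_all add: rk_def nul_def)
  then show ?thesis using \<open>a \<noteq> 0\<close> by (simp add: power_int_add)
qed

lemma BR_poly_subdiv:
  fixes a b c :: "'a::field"
  assumes "a \<noteq> 0" and "a + 2 \<noteq> 0"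
  shows "BR_poly subdiv a b c
    = (a + 2) powi nul F * BR_poly F (a * (a + 2)) (b / (a + 2)) c"
proof -
  define t where "t x y H = x powi (rk F - rk H) * y powi nul H * c powi (num_k H - num_p H + nul H)"
    for x y and H :: "('v, 'd) pre_ribbon_graph"
  let ?H = "spanning_sub F"
  have "BR_poly subdiv a b c
      = (\<Sum>S\<in>Pow (darts F). a ^ card (empty_edges S) * t a b (?H (full_edges S)))"
    unfolding BR_poly_def states_subdiv sum.reindex[OF inj_sub_state] comp_apply t_def
    using \<open>a \<noteq> 0\<close> by (intro sum.cong refl BR_poly_term_sub_state) auto
  \<comment> \<open>The factor \<open>t\<close> depends on \<open>S\<close> only through its full
    edges, so grouping by them leaves a single term of \<open>F\<close> in each group.\<close>
  also have "\<dots> = (\<Sum>A\<in>Pow (edges F). \<Sum>S | S \<in> Pow (darts F) \<and> full_edges S = A.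
      a ^ card (empty_edges S) * t a b (?H (full_edges S)))"
    using finite_darts finite_edges
    by (intro sum.group[symmetric]) (auto simp: full_edges_def)
  also have "\<dots> = (\<Sum>A\<in>Pow (edges F). (a + 2) ^ card (edges F - A) * t a b (?H A))"
    by (intro sum.cong refl) (simp flip: sum_over_full_edges add: sum_distrib_right)
  also have "\<dots> = (\<Sum>A\<in>Pow (edges F).
      (a + 2) powi nul F * t (a * (a + 2)) (b / (a + 2)) (?H A))"
  proof (rule sum.cong[OF refl])
    fix A assume A: "A \<in> Pow (edges F)"
    have "num_e (?H A) = int (card A)" "num_v (?H A) = num_v F"
      using A by (simp_all add: num_e_def num_v_def edges_spanning_sub)
    moreover have "int (card (edges F - A)) = num_e F - int (card A)"
      using A finite_edges finite_subset[of A "edges F"]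
      by (simp add: num_e_def card_Diff_subset of_nat_diff card_mono)
    ultimately have "int (card (edges F - A)) = nul F + (rk F - rk (?H A)) - nul (?H A)"
      by (simp add: nul_def rk_def)
    \<comment> \<open>The three factors are absorbed in turn by the prefactor, by the first argument
      \<open>a * (a + 2)\<close> and by the second argument \<open>b / (a + 2)\<close>.\<close>
    then have "(a + 2) ^ card (edges F - A)
        = (a + 2) powi nul F * (a + 2) powi (rk F - rk (?H A)) / (a + 2) powi nul (?H A)"
      using \<open>a + 2 \<noteq> 0\<close> by (simp add: power_int_add power_int_diff flip: power_int_of_nat)
    then show "(a + 2) ^ card (edges F - A) * t a b (?H A)
        = (a + 2) powi nul F * t (a * (a + 2)) (b / (a + 2)) (?H A)"
      by (simp add: t_def power_int_mult_distrib power_int_divide_distrib)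
  qed
  also have "\<dots> = (a + 2) powi nul F * (\<Sum>H\<in>?H ` Pow (edges F). t (a * (a + 2)) (b / (a + 2)) H)"
    by (simp add: sum.reindex[OF inj_spanning_sub] sum_distrib_left)
  also have "?H ` Pow (edges F) = states F"
    by (auto simp: states_def)
  finally show ?thesis
    by (simp add: BR_poly_def t_def)
qed

end

text \<open>\<open>s\<close> may be either square root of \<open>\<alpha> * \<beta>\<close>, so the
  identity holds for both branches; the conditions on \<open>\<alpha>\<close> make \<open>s\<close>
  nonzero.\<close>

theorem theorem5p2:
  fixes F :: "('v, 'd) pre_ribbon_graph" and \<alpha> \<beta> \<gamma> s :: complex
  assumes "ribbon_graph F"
    and "\<alpha> \<noteq> - 2" and "\<alpha> \<noteq> 0" and "\<alpha> \<noteq> 1"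
    and "\<beta> = \<alpha> * (1 - \<alpha>)"
    and "s\<^sup>2 = \<alpha> * \<beta>" and "\<gamma> = 1 / s"
  shows "BR_poly (tensor_cycle F 3) \<alpha> \<beta> \<gamma>
         = (\<alpha> + 2) powi nul F * BR_poly F (\<alpha> * (\<alpha> + 2)) (\<beta> / (\<alpha> + 2)) \<gamma>"
proof -
  interpret ribbon_graph F by fact
  have "\<alpha> + 2 \<noteq> 0" using \<open>\<alpha> \<noteq> - 2\<close> by (simp add: add_eq_0_iff2)
  with \<open>\<alpha> \<noteq> 0\<close> show ?thesis by (rule BR_poly_subdiv)
qed

end
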